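(* Let $M$ be a positive integer such that $M+1$ is congruent to $2$ or $3$ modulo $5$. Then $$ \begin{aligned} 1&+q^2\,\frac{\left(\sum_{i=0}^{M-2}q^i\right)+tq^{M-1}+q^M}{1-tq^{M+1}} +\sum_{k=2}^M \frac{q^{k(k+1)}}{\prod_{i=2}^{k}(1-q^i)}\cdot\frac{[M+1]_q}{1-tq^{M+1}}\\ &+\sum_{k=M+1}^\infty \frac{q^{k(k+1)}}{(1-tq^{M+1})\prod_{1\le i\le k,\ i\ne M+1}(1-q^i)} =\frac{1-q^{M+1}}{1-tq^{M+1}}\prod_{k=0}^\infty\frac{1}{(1-q^{5k+2})(1-q^{5k+3})}. \end{aligned} $$
   Context: $[n]_q=1+q+\cdots+q^{n-1}$ for a positive integer $n$. Empty sums are $0$ and empty products are $1$. The identity is one of formal power series in $q$ with coefficients in $\mathbb{Z}[t]$. *)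

theory Defs
  imports "HOL-Analysis.Infinite_Products" "HOL-Computational_Algebra.Formal_Power_Series"
    "HOL-Computational_Algebra.Polynomial"
begin

abbreviation qX :: "int poly fps" where
  "qX \<equiv> fps_X"

text \<open>The indeterminate \<open>t\<close> of the coefficient ring, as a constant power series.\<close>
abbreviation tX :: "int poly fps" where
  "tX \<equiv> fps_const [:0, 1:]"

definition q_int :: "nat \<Rightarrow> int poly fps" where
  "q_int n = (\<Sum>i<n. qX ^ i)"

text \<open>
  Integer polynomials do not form an instance of the class \<open>inverse\<close>, so the library's division of
  power series is not available over them. The quotient below is meaningful only for denominators
  with constant coefficient 1, for which it is the unique \<open>h\<close> with \<open>h * g = f\<close>.
\<close>
definition fps_quot :: "int poly fps \<Rightarrow> int poly fps \<Rightarrow> int poly fps" (infixl \<open>\<oslash>\<close> 70) where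
  "f \<oslash> g = f * fps_right_inverse g 1"

lemma fps_quot_eq_iff:
  assumes "fps_nth g 0 = 1"
  shows "f \<oslash> g = h \<longleftrightarrow> f = h * g"
proof -
  have "g * fps_right_inverse g 1 = 1"
    by (rule fps_right_inverse) (simp add: assms)
  then obtain r where r: "fps_right_inverse g 1 = r" "g * r = 1"
    by blast
  show ?thesis
    unfolding fps_quot_def r(1)
  proof
    assume "f * r = h"
    have "f * r * g = f * (g * r)"
      by (simp only: ac_simps)
    with \<open>f * r = h\<close> have "h * g = f * (g * r)"
      by simp
    then show "f = h * g"
      by (simp only: r(2) mult_1_right)
  next
    assume "f = h * g"
    then have "f * r = h * (g * r)"
      by (simp only: mult.assoc)
    then show "f * r = h"
      by (simp only: r(2) mult_1_right)
  qed
qed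

end

theory Submission
  imports Defs
begin

text \<open>
  Clearing the factor \<open>(1 - q\<^bsup>M+1\<^esup>) / (1 - t q\<^bsup>M+1\<^esup>)\<close> turns the left-hand side into
  \<open>\<Sum>k. q\<^bsup>k(k+1)\<^esup> / (q)\<^sub>k\<close>, so the theorem is the second Rogers--Ramanujan identity. Following Rogers,
  the sums \<open>R\<^sub>m = \<Sum>k. q\<^bsup>k\<^sup>2+mk\<^esup> / (q)\<^sub>k\<close> satisfy \<open>R\<^sub>m = R\<^bsub>m+1\<^esub> + q\<^bsup>m+1\<^esup> R\<^bsub>m+2\<^esub>\<close>, as does an
  explicit alternating series \<open>T\<^sub>m\<close>, and \<open>(q)\<^sub>\<infinity> R\<^sub>m\<close> and \<open>T\<^sub>m\<close> have the same limit for \<open>m \<rightarrow> \<infinity>\<close>; hence they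
  agree. For \<open>m = 1\<close> the series is a theta function, which a finite form of the Jacobi triple product
  turns into a product. Every step is a congruence modulo a power of \<open>q\<close> between finite sums and
  products, so that limits enter only at the very end.
\<close>

unbundle no vec_syntax
unbundle fps_syntax

section \<open>Congruences between power series\<close>

text \<open>Divisibility makes compatibility with the ring operations immediate;
  \<open>fps_cong_iff_nth\<close> translates it into agreement of the first \<open>L\<close>
  coefficients.\<close>

definition fps_cong :: "nat \<Rightarrow> 'a::comm_ring_1 fps \<Rightarrow> 'a fps \<Rightarrow> bool" where
  "fps_cong L f g \<longleftrightarrow> fps_X ^ L dvd f - g"

lemma fps_cong_refl [simp]: "fps_cong L f f"
  by (simp add: fps_cong_def)

lemma fps_cong_sym: "fps_cong L f g \<Longrightarrow> fps_cong L g f"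
  unfolding fps_cong_def by (metis dvd_minus_iff minus_diff_eq)

lemma fps_cong_trans [trans]: "fps_cong L f g \<Longrightarrow> fps_cong L g h \<Longrightarrow> fps_cong L f h"
  unfolding fps_cong_def using dvd_add[of "fps_X ^ L" "f - g" "g - h"] by simp

lemma fps_cong_mono: "fps_cong L f g \<Longrightarrow> L' \<le> L \<Longrightarrow> fps_cong L' f g"
  unfolding fps_cong_def by (meson dvd_trans le_imp_power_dvd)

lemma fps_cong_add: "fps_cong L f g \<Longrightarrow> fps_cong L f' g' \<Longrightarrow> fps_cong L (f + f') (g + g')"
  unfolding fps_cong_def by (metis add_diff_add dvd_add)

lemma fps_cong_mult_left: "fps_cong L f g \<Longrightarrow> fps_cong L (h * f) (h * g)"
  unfolding fps_cong_def by (metis dvd_mult right_diff_distrib)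

lemma fps_cong_mult_right: "fps_cong L f g \<Longrightarrow> fps_cong L (f * h) (g * h)"
  using fps_cong_mult_left[of L f g h] by (simp add: mult.commute)

lemma fps_cong_mult: "fps_cong L f g \<Longrightarrow> fps_cong L f' g' \<Longrightarrow> fps_cong L (f * f') (g * g')"
  by (meson fps_cong_mult_left fps_cong_mult_right fps_cong_trans)

lemma fps_cong_sum: "(\<And>i. i \<in> A \<Longrightarrow> fps_cong L (f i) (g i)) \<Longrightarrow> fps_cong L (sum f A) (sum g A)"
  by (induction A rule: infinite_finite_induct) (auto intro: fps_cong_add)

lemma fps_cong_add_dvd: "fps_X ^ L dvd h \<Longrightarrow> fps_cong L (f + h) f"
  by (simp add: fps_cong_def)

lemma fps_cong_X_power_mult:
  "fps_cong L f g \<Longrightarrow> fps_cong (k + L) (fps_X ^ k * f) (fps_X ^ k * g)"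
  unfolding fps_cong_def by (metis mult_dvd_mono dvd_refl power_add right_diff_distrib)

lemma fps_X_power_dvd_iff: "fps_X ^ L dvd (f :: 'a::comm_ring_1 fps) \<longleftrightarrow> (\<forall>i<L. f $ i = 0)"
proof
  assume "fps_X ^ L dvd f"
  then obtain g where "f = fps_X ^ L * g" ..
  then show "\<forall>i<L. f $ i = 0"
    by (simp add: fps_X_power_mult_nth)
next
  assume "\<forall>i<L. f $ i = 0"
  then have "fps_cutoff L f = 0"
    by (simp add: fps_eq_iff)
  then have "f = fps_X ^ L * fps_shift L f"
    using fps_shift_cutoff'[of L f] by simp
  then show "fps_X ^ L dvd f"
    by (metis dvd_triv_left)
qed

lemma fps_cong_iff_nth: "fps_cong L f g \<longleftrightarrow> (\<forall>i<L. f $ i = g $ i)"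
  by (simp add: fps_cong_def fps_X_power_dvd_iff)

lemma fps_cong_tendsto:
  assumes "\<And>n. fps_cong n (f n) g"
  shows "f \<longlonglongrightarrow> g"
proof (rule tendsto_fpsI)
  fix n
  show "\<forall>\<^sub>F x in sequentially. f x $ n = g $ n"
    using eventually_gt_at_top[of n]
    by eventually_elim (use assms in \<open>auto simp: fps_cong_iff_nth\<close>)
qed

lemma fps_cong_limit:
  assumes "\<And>n. fps_cong n (f (Suc n)) (f n)"
  obtains g where "\<And>n. fps_cong n (f n) g"
proof
  fix n
  have mono: "fps_cong i (f j) (f i)" if "i \<le> j" for i j
    using that
  proof (induction rule: dec_induct)
    case (step j)
    then show ?case
      using assms[of j] fps_cong_mono fps_cong_trans by blast
  qed simp
  \<comment> \<open>Coefficient \<open>i\<close> no longer changes from index \<open>i + 1\<close>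
    on, so the limit is read off a shifted diagonal.\<close>
  show "fps_cong n (f n) (Abs_fps (\<lambda>i. f (Suc i) $ i))"
    unfolding fps_cong_iff_nth using mono[of "Suc _" n] by (auto simp: fps_cong_iff_nth)
qed

section \<open>Reciprocals and Pochhammer products\<close>

abbreviation fps_recip :: "'a::comm_ring_1 fps \<Rightarrow> 'a fps" where
  "fps_recip f \<equiv> fps_right_inverse f 1"

lemma fps_recip_right: "f $ 0 = 1 \<Longrightarrow> f * fps_recip f = 1"
  by (simp add: fps_right_inverse)

lemma fps_recip_left: "f $ 0 = 1 \<Longrightarrow> fps_recip f * f = 1"
  using fps_recip_right[of f] by (simp add: mult.commute)

lemma fps_recip_unique:
  assumes "f * g = 1" "f $ 0 = 1"
  shows "g = fps_recip f"
proof -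
  have "g = fps_recip f * (f * g)"
    by (simp only: mult.assoc[symmetric] fps_recip_left[OF assms(2)] mult_1_left)
  with assms(1) show ?thesis
    by simp
qed

lemma fps_recip_mult:
  assumes "f $ 0 = 1" "g $ 0 = 1"
  shows "fps_recip (f * g) = fps_recip f * fps_recip g"
proof (rule fps_recip_unique[symmetric])
  have "f * g * (fps_recip f * fps_recip g) = (f * fps_recip f) * (g * fps_recip g)"
    by (simp only: mult_ac)
  then show "f * g * (fps_recip f * fps_recip g) = 1"
    by (simp only: fps_recip_right assms mult_1_left)
qed (simp add: assms)

lemma fps_recip_cancel_left:
  assumes "f $ 0 = 1" "g $ 0 = 1"
  shows "fps_recip (f * g) * f = fps_recip g"
proof -
  have "fps_recip (f * g) * f = (f * fps_recip f) * fps_recip g"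
    by (simp only: fps_recip_mult[OF assms] mult_ac)
  then show ?thesis
    by (simp only: fps_recip_right assms mult_1_left)
qed

lemma fps_cong_unit_cancel:
  assumes "u $ 0 = 1" "fps_cong L (u * f) (u * g)"
  shows "fps_cong L f g"
  using fps_cong_mult_left[OF assms(2), of "fps_recip u"]
  by (simp only: mult.assoc[symmetric] fps_recip_left[OF assms(1)] mult_1_left)

text \<open>The q-Pochhammer symbol \<open>(q^s; q^s)_n\<close>, needed for \<open>s = 1\<close> and
  \<open>s = 5\<close>.\<close>

definition qpoch :: "nat \<Rightarrow> nat \<Rightarrow> 'a::comm_ring_1 fps" where
  "qpoch s n = (\<Prod>i=1..n. 1 - fps_X ^ (s * i))"

lemma qpoch_0 [simp]: "qpoch s 0 = 1"
  by (simp add: qpoch_def)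

lemma qpoch_Suc [simp]: "qpoch s (Suc n) = qpoch s n * (1 - fps_X ^ (s * Suc n))"
  by (simp add: qpoch_def prod.cl_ivl_Suc mult.commute)

lemma fps_prod_nth_0': "prod f A $ 0 = (\<Prod>x\<in>A. f x $ 0)"
  by (induction A rule: infinite_finite_induct) auto

lemma qpoch_nth_0 [simp]: "s > 0 \<Longrightarrow> qpoch s n $ 0 = 1"
  by (simp add: qpoch_def fps_prod_nth_0')

text \<open>The modulus is the exponent of the first factor left out.\<close>

lemma fps_cong_qpoch:
  assumes "n \<le> m"
  shows "fps_cong (s * Suc n) (qpoch s m) (qpoch s n)"
  using assms
proof (induction rule: dec_induct)
  case (step m)
  have "fps_X ^ (s * Suc n) dvd fps_X ^ (s * Suc m)"
    using step.hyps by (intro le_imp_power_dvd) simp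
  then have "fps_cong (s * Suc n) (1 - fps_X ^ (s * Suc m)) 1"
    by (simp add: fps_cong_def)
  from fps_cong_mult[OF step.IH this] show ?case
    by simp
qed simp

section \<open>The recurrence of Rogers\<close>

definition rogers_sum :: "nat \<Rightarrow> nat \<Rightarrow> 'a::comm_ring_1 fps" where
  "rogers_sum K m = (\<Sum>k<K. fps_X ^ (k * k + m * k) * fps_recip (qpoch 1 k))"

lemma recip_qpoch_Suc:
  assumes "s > 0"
  shows "fps_recip (qpoch s (Suc n)) * (1 - fps_X ^ (s * Suc n)) = fps_recip (qpoch s n)"
  using fps_recip_cancel_left[of "1 - fps_X ^ (s * Suc n)" "qpoch s n"] assms
  by (simp add: mult.commute)

text \<open>Split the summand by \<open>1 = q^k + (1 - q^k)\<close>. The first part raises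
  \<open>m\<close> by one; in the second, \<open>1 - q^k\<close> cancels the last factor of
  \<open>(q)_k\<close>, and shifting \<open>k\<close> by one gives the last sum, which is therefore
  one term shorter.\<close>

lemma rogers_sum_rec:
  "rogers_sum (Suc K) m = rogers_sum (Suc K) (Suc m) + fps_X ^ Suc m * rogers_sum K (m + 2)"
proof (induction K)
  case 0
  show ?case by (simp add: rogers_sum_def)
next
  case (Suc K)
  let ?r = "fps_recip (qpoch 1 (Suc K)) :: 'a fps"
  let ?e = "Suc K * Suc K + m * Suc K"
  have "fps_X ^ ?e * ?r = fps_X ^ (?e + Suc K) * ?r + fps_X ^ ?e * (?r * (1 - fps_X ^ (1 * Suc K)))"
    by (simp add: power_add algebra_simps)
  also have "\<dots> = fps_X ^ (Suc K * Suc K + Suc m * Suc K) * ?r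
      + fps_X ^ Suc m * (fps_X ^ (K * K + (m + 2) * K) * fps_recip (qpoch 1 K))"
    unfolding recip_qpoch_Suc[OF zero_less_one]
    by (simp add: algebra_simps power_add)
  finally show ?case
    using Suc.IH by (simp add: rogers_sum_def algebra_simps del: qpoch_Suc)
qed

lemma fps_cong_rogers_sum_Suc: "fps_cong K (rogers_sum (Suc K) m) (rogers_sum K m)"
  unfolding rogers_sum_def sum.lessThan_Suc
  by (intro fps_cong_add_dvd dvd_mult2 le_imp_power_dvd) (cases K; simp)

lemma fps_cong_rogers_sum_1: "fps_cong m (rogers_sum (Suc K) m) 1"
  unfolding rogers_sum_def sum.lessThan_Suc_shift
proof -
  have "fps_recip (qpoch 1 0) = (1 :: 'a fps)"
    using fps_recip_unique[of "1 :: 'a fps" 1] by simp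
  then show "fps_cong m (fps_X ^ (0 * 0 + m * 0) * fps_recip (qpoch 1 0)
      + (\<Sum>k<K. fps_X ^ (Suc k * Suc k + m * Suc k) * fps_recip (qpoch 1 (Suc k)))) (1 :: 'a fps)"
    by (simp only: mult_0_right add_0_right power_0 mult_1_left,
        intro fps_cong_add_dvd dvd_sum dvd_mult2 le_imp_power_dvd) simp
qed

section \<open>The alternating theta series and its recurrence\<close>

definition shifted_qpoch :: "nat \<Rightarrow> nat \<Rightarrow> 'a::comm_ring_1 fps" where
  "shifted_qpoch n r = (\<Prod>i<r. 1 - fps_X ^ (n + i + 1))"

lemma shifted_qpoch_Suc:
  "shifted_qpoch n (Suc r) = shifted_qpoch n r * (1 - fps_X ^ (n + r + 1))"
  by (simp add: shifted_qpoch_def)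

lemma shifted_qpoch_Suc_left:
  "(1 - fps_X ^ (n + 1)) * shifted_qpoch (n + 1) r = shifted_qpoch n (Suc r)"
  unfolding shifted_qpoch_def prod.lessThan_Suc_shift by simp

text \<open>
  The exponent in \<open>theta_coeff\<close> is \<open>n(5n+3)/2\<close>. In the series \<open>T\<^sub>m\<close> the Pochhammer quotient
  \<open>(q)\<^bsub>m+n-1\<^esub> / (q)\<^sub>n\<close> is a polynomial only for \<open>m \<ge> 1\<close>, hence \<open>theta_term r\<close> is its summand for
  \<open>m = r + 1\<close>.
\<close>
definition theta_coeff :: "nat \<Rightarrow> 'a::comm_ring_1 fps" where
  "theta_coeff n = (-1) ^ n * fps_X ^ (5 * (n choose 2) + 4 * n)"

lemma theta_coeff_0 [simp]: "theta_coeff 0 = 1"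
  by (simp add: theta_coeff_def binomial_eq_0)

lemma theta_coeff_Suc: "theta_coeff (Suc n) = - theta_coeff n * fps_X ^ (5 * n + 4)"
proof -
  have "5 * (Suc n choose 2) + 4 * Suc n = (5 * (n choose 2) + 4 * n) + (5 * n + 4)"
    by (simp add: numeral_2_eq_2)
  then show ?thesis
    by (simp only: theta_coeff_def power_add[of _ _ "5 * n + 4"]) (simp add: mult_ac)
qed

definition theta_term :: "nat \<Rightarrow> nat \<Rightarrow> 'a::comm_ring_1 fps" where
  "theta_term r n =
     theta_coeff n * fps_X ^ (2 * r * n) * (1 - fps_X ^ (r + 2 * n + 1)) * shifted_qpoch n r"

definition theta_sum :: "nat \<Rightarrow> nat \<Rightarrow> 'a::comm_ring_1 fps" where
  "theta_sum K r = (\<Sum>n<K. theta_term r n)"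

text \<open>A telescoping certificate for the recurrence of \<open>theta_sum\<close>. The factor
  \<open>1 - q^n\<close> kills the boundary term at \<open>n = 0\<close>, and
  \<open>theta_coeff n\<close> makes the upper one divisible by \<open>q^n\<close>.\<close>

definition theta_cert :: "nat \<Rightarrow> nat \<Rightarrow> 'a::comm_ring_1 fps" where
  "theta_cert r n = theta_coeff n * fps_X ^ (2 * r * n) * (1 - fps_X ^ n)
     * (shifted_qpoch n r + fps_X ^ n * shifted_qpoch n (Suc r))"

lemma theta_term_telescope:
  "theta_term r n - theta_term (Suc r) n - fps_X ^ (r + 2) * theta_term (r + 2) n
     = theta_cert r n - theta_cert r (Suc n)"
proof -
  \<comment> \<open>In terms of \<open>x = q^n\<close>, \<open>y = q^r\<close> and the common
    factors \<open>s\<close> and \<open>A\<close>, the claim is a polynomial identity.\<close>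
  define s where "s = theta_coeff n * (fps_X :: 'a fps) ^ (2 * r * n)"
  define x where "x = (fps_X :: 'a fps) ^ n"
  define y where "y = (fps_X :: 'a fps) ^ r"
  define A where "A = (shifted_qpoch n r :: 'a fps)"
  let ?X = "fps_X :: 'a fps"
  have A1: "shifted_qpoch n (Suc r) = A * (1 - x * y * ?X)"
    by (simp add: shifted_qpoch_Suc A_def x_def y_def power_add mult_ac)
  have A2: "shifted_qpoch n (Suc (Suc r)) = A * (1 - x * y * ?X) * (1 - x * y * ?X\<^sup>2)"
    using A1 by (simp add: shifted_qpoch_Suc x_def y_def power_add power2_eq_square mult_ac)
  \<comment> \<open>The factor \<open>1 - q^(n+1)\<close> of the certificate at \<open>n + 1\<close>
    completes the products that start one place later, so that \<open>A\<close> can be split off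
    there too.\<close>
  have B: "(1 - ?X ^ Suc n) * (shifted_qpoch (Suc n) r + ?X ^ Suc n * shifted_qpoch (Suc n) (Suc r))
      = A * (1 - x * y * ?X) + x * ?X * (A * (1 - x * y * ?X) * (1 - x * y * ?X\<^sup>2))"
  proof -
    have "(1 - ?X ^ Suc n) * (shifted_qpoch (Suc n) r + ?X ^ Suc n * shifted_qpoch (Suc n) (Suc r))
        = (1 - ?X ^ (n + 1)) * shifted_qpoch (n + 1) r
          + x * ?X * ((1 - ?X ^ (n + 1)) * shifted_qpoch (n + 1) (Suc r))"
      by (simp add: x_def algebra_simps)
    then show ?thesis
      unfolding shifted_qpoch_Suc_left A1 A2 .
  qed
  have pw: "?X ^ (2 * Suc r * n) = ?X ^ (2 * r * n) * x\<^sup>2"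
    "?X ^ (2 * (r + 2) * n) = ?X ^ (2 * r * n) * x ^ 4"
    "?X ^ (2 * r * Suc n) = ?X ^ (2 * r * n) * y\<^sup>2"
    "?X ^ (r + 2 * n + 1) = x\<^sup>2 * y * ?X"
    "?X ^ (Suc r + 2 * n + 1) = x\<^sup>2 * y * ?X\<^sup>2"
    "?X ^ (r + 2 + 2 * n + 1) = x\<^sup>2 * y * ?X ^ 3"
    "?X ^ (5 * n + 4) = x ^ 5 * ?X ^ 4"
    "?X ^ (r + 2) = y * ?X\<^sup>2"
    unfolding x_def y_def
    by (simp_all add: algebra_simps flip: power_add power_mult power_Suc power_Suc2)
  have t0: "theta_term r n = s * (1 - x\<^sup>2 * y * ?X) * A"
    by (simp only: theta_term_def pw s_def A_def)
  have t1: "theta_term (Suc r) n = s * x\<^sup>2 * (1 - x\<^sup>2 * y * ?X\<^sup>2) * (A * (1 - x * y * ?X))"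
    unfolding theta_term_def A1 pw s_def by (simp only: mult_ac)
  have t2: "theta_term (r + 2) n
      = s * x ^ 4 * (1 - x\<^sup>2 * y * ?X ^ 3) * (A * (1 - x * y * ?X) * (1 - x * y * ?X\<^sup>2))"
    unfolding theta_term_def A2[folded add_2_eq_Suc'] pw s_def by (simp only: mult_ac)
  have c0: "theta_cert r n = s * (1 - x) * (A + x * (A * (1 - x * y * ?X)))"
    by (simp only: theta_cert_def A1 s_def x_def A_def)
  have "theta_cert r (Suc n) = (- s * x ^ 5 * ?X ^ 4 * y\<^sup>2)
      * ((1 - ?X ^ Suc n) * (shifted_qpoch (Suc n) r + ?X ^ Suc n * shifted_qpoch (Suc n) (Suc r)))"
    unfolding theta_cert_def theta_coeff_Suc pw s_def
    by (simp only: mult_ac mult_minus_left mult_minus_right)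
  note c1 = this[unfolded B]
  show ?thesis
    unfolding t0 t1 t2 c0 c1 pw by (simp add: algebra_simps eval_nat_numeral)
qed

lemma theta_sum_rec:
  "fps_cong K (theta_sum K r) (theta_sum K (Suc r) + fps_X ^ (r + 2) * theta_sum K (r + 2))"
proof -
  have "theta_sum K r - (theta_sum K (Suc r) + fps_X ^ (r + 2) * theta_sum K (r + 2))
      = (\<Sum>n<K. theta_cert r n - theta_cert r (Suc n) :: 'a fps)"
    unfolding theta_sum_def sum_distrib_left theta_term_telescope[symmetric] sum_subtractf
    by (simp add: algebra_simps)
  also have "\<dots> = - theta_cert r K"
    by (simp only: sum_lessThan_telescope') (simp add: theta_cert_def)
  also have "fps_X ^ K dvd \<dots>"
    unfolding theta_cert_def theta_coeff_def dvd_minus_iff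
    by (intro dvd_mult2 dvd_mult le_imp_power_dvd) simp
  finally show ?thesis
    by (simp add: fps_cong_def)
qed

text \<open>The term \<open>n = 0\<close> is \<open>(1 - q^(r+1)) (q)_r = (q)_(r+1)\<close>; all
  later terms have order at least \<open>r + 1\<close>.\<close>

lemma fps_cong_theta_sum_qpoch: "fps_cong (Suc r) (theta_sum (Suc K) r) (qpoch 1 (Suc r))"
proof -
  have "shifted_qpoch 0 r = (qpoch 1 r :: 'a fps)"
    by (induction r) (simp_all add: shifted_qpoch_def)
  then have "theta_sum (Suc K) r = qpoch 1 (Suc r) + (\<Sum>n<K. theta_term r (Suc n) :: 'a fps)"
    unfolding theta_sum_def sum.lessThan_Suc_shift by (simp add: theta_term_def mult.commute)
  moreover have "fps_X ^ Suc r dvd (theta_term r (Suc n) :: 'a fps)" for n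
    unfolding theta_term_def theta_coeff_def mult.assoc power_add[symmetric]
      mult.assoc[symmetric, of "fps_X ^ _" "fps_X ^ _"]
    by (intro dvd_mult dvd_mult2 le_imp_power_dvd) simp
  ultimately show ?thesis
    by (simp only: fps_cong_add_dvd dvd_sum)
qed

text \<open>Both sides obey the same recurrence modulo \<open>q^N\<close>, which expresses index
  \<open>r\<close> by larger indices. The induction ends at \<open>r \<ge> N\<close>, where both are
  congruent to \<open>(q)_N\<close>.\<close>

lemma fps_cong_rogers_sum_theta_sum:
  assumes "N \<le> L"
  shows "fps_cong N (qpoch 1 L * rogers_sum (Suc N) (Suc r)) (theta_sum (Suc N) r)"
proof (induction "N - r" arbitrary: r rule: less_induct)
  case less
  let ?Q = "qpoch 1 L :: 'a fps"
  show ?case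
  proof (cases "N \<le> r")
    case True
    have "fps_cong N (?Q * rogers_sum (Suc N) (Suc r)) (?Q * 1)"
      by (intro fps_cong_mult_left fps_cong_mono[OF fps_cong_rogers_sum_1]) (use True in simp)
    also have "fps_cong N (?Q * 1) (qpoch 1 N)"
      using fps_cong_qpoch[OF assms, of 1] by (auto intro: fps_cong_mono)
    also have "fps_cong N (qpoch 1 N) (qpoch 1 (Suc r) :: 'a fps)"
      by (rule fps_cong_sym, rule fps_cong_mono[OF fps_cong_qpoch[of N "Suc r" 1]])
        (use True in simp_all)
    also have "fps_cong N (qpoch 1 (Suc r) :: 'a fps) (theta_sum (Suc N) r)"
      by (rule fps_cong_sym, rule fps_cong_mono[OF fps_cong_theta_sum_qpoch]) (use True in simp)
    finally show ?thesis .
  next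
    case False
    have "?Q * rogers_sum (Suc N) (Suc r)
        = ?Q * rogers_sum (Suc N) (Suc (Suc r)) + fps_X ^ (r + 2) * (?Q * rogers_sum N (Suc (r + 2)))"
      unfolding rogers_sum_rec[of N "Suc r"] by (simp add: algebra_simps)
    \<comment> \<open>The recurrence shortens the second sum to \<open>N\<close> terms; the missing
      term has order at least \<open>N\<close>.\<close>
    also have "fps_cong N \<dots> (?Q * rogers_sum (Suc N) (Suc (Suc r))
        + fps_X ^ (r + 2) * (?Q * rogers_sum (Suc N) (Suc (r + 2))))"
      by (intro fps_cong_add fps_cong_mult_left fps_cong_refl
          fps_cong_sym[OF fps_cong_rogers_sum_Suc])
    also have "fps_cong N \<dots> (theta_sum (Suc N) (Suc r) + fps_X ^ (r + 2) * theta_sum (Suc N) (r + 2))"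
      by (intro fps_cong_add fps_cong_mult_left less) (use False in auto)
    also have "fps_cong N \<dots> (theta_sum (Suc N) r)"
      by (rule fps_cong_mono[OF fps_cong_sym[OF theta_sum_rec]]) simp
    finally show ?thesis .
  qed
qed

section \<open>A finite Jacobi triple product\<close>

text \<open>The \<open>q^5\<close>-binomial coefficient of \<open>2 * N + 1\<close> over
  \<open>N - n\<close>, divided by \<open>(q^5; q^5)_(2N+1)\<close>. The value 0 beyond
  \<open>N\<close> is the natural one and keeps truncated subtraction out.\<close>

definition jacobi_weight :: "nat \<Rightarrow> nat \<Rightarrow> 'a::comm_ring_1 fps" where
  "jacobi_weight N n = (if n \<le> N then fps_recip (qpoch 5 (N - n) * qpoch 5 (N + n + 1)) else 0)"

text \<open>A bilateral sum folded in half: the indices \<open>n\<close> and \<open>-n-1\<close>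
  have the same weight, opposite signs, and exponents differing by \<open>2 * n + 1\<close>.\<close>

definition jacobi_sum :: "nat \<Rightarrow> 'a::comm_ring_1 fps" where
  "jacobi_sum N = (\<Sum>n\<le>N. theta_coeff n * (1 - fps_X ^ (2 * n + 1)) * jacobi_weight N n)"

text \<open>
  The Wilf--Zeilberger companion of the summand of \<open>jacobi_sum\<close>. Here \<open>g(n)\<close> is the companion
  of the bilateral Jacobi sum, and this is \<open>g(n) - g(-n)\<close>, which vanishes at \<open>n = 0\<close>.
\<close>
definition jacobi_cert :: "nat \<Rightarrow> nat \<Rightarrow> 'a::comm_ring_1 fps" where
  "jacobi_cert N n = (if n \<le> N then theta_coeff n * fps_recip (qpoch 5 (N - n) * qpoch 5 (N + n))
       * ((fps_X - fps_X ^ (5 * N)) * (fps_X ^ (5 * N) - fps_X ^ (5 * (N - n)) * fps_X ^ (2 * n))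
          + (1 - fps_X ^ (5 * N) * fps_X) * (fps_X ^ (5 * (N - n)) - fps_X ^ (5 * N) * fps_X ^ (2 * n)))
     else 0)"

text \<open>Also true for \<open>n = Suc N\<close>, where the factor \<open>1 - q^0\<close> vanishes
  together with the left-hand side.\<close>

lemma jacobi_weight_Suc:
  assumes "n \<le> Suc N"
  shows "jacobi_weight N n = jacobi_weight (Suc N) n
           * (1 - fps_X ^ (5 * (Suc N - n))) * (1 - fps_X ^ (5 * Suc (Suc N + n)))"
proof (cases "n = Suc N")
  case False
  with assms have n: "n \<le> N" by simp
  then have "qpoch 5 (Suc N - n) * qpoch 5 (Suc N + n + 1)
     = (1 - fps_X ^ (5 * (Suc N - n))) * (1 - fps_X ^ (5 * Suc (Suc N + n)))
        * (qpoch 5 (N - n) * qpoch 5 (N + n + 1) :: 'a fps)"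
    by (simp add: Suc_diff_le mult_ac)
  with n show ?thesis
    using fps_recip_cancel_left[of "(1 - fps_X ^ (5 * (Suc N - n))) * (1 - fps_X ^ (5 * Suc (Suc N + n)))"
        "qpoch 5 (N - n) * qpoch 5 (N + n + 1) :: 'a fps"]
    by (simp add: jacobi_weight_def mult.assoc del: qpoch_Suc)
qed (simp add: jacobi_weight_def)

text \<open>The polynomial core of \<open>jacobi_telescope\<close>, with \<open>p\<close> standing
  for \<open>q^4\<close>, \<open>e\<close> for \<open>q^(5(N-n))\<close> and \<open>z\<close> for
  \<open>q^(5n)\<close>.\<close>

lemma jacobi_telescope_identity:
  fixes q :: "'a::comm_ring_1"
  assumes "d = e * (q * p)" "a = e * (q * p) * z" "b = e * p * z"
  shows "(1 - a\<^sup>2) * (1 - a\<^sup>2 * (q * p)) * (s * (1 - q * Y) * w)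
       - (1 - a * q) * (1 - b) * (s * (1 - q * Y) * (w * (1 - d) * (1 - a * z * (q * p))))
     = s * (w * (1 - a * z * (q * p))) * ((q - a) * (a - d * Y) + (1 - a * q) * (d - a * Y))
       - (- s * (z * p)) * (w * (1 - d))
         * ((q - a) * (a - e * (Y * q\<^sup>2)) + (1 - a * q) * (e - a * (Y * q\<^sup>2)))"
  unfolding assms by (simp add: algebra_simps power2_eq_square)

lemma jacobi_telescope:
  assumes "n \<le> Suc N"
  shows "(1 - fps_X ^ (5 * (2 * N + 2))) * (1 - fps_X ^ (5 * (2 * N + 3)))
       * (theta_coeff n * (1 - fps_X ^ (2 * n + 1)) * jacobi_weight (Suc N) n)
     - (1 - fps_X ^ (5 * N + 6)) * (1 - fps_X ^ (5 * N + 4))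
       * (theta_coeff n * (1 - fps_X ^ (2 * n + 1)) * jacobi_weight N n)
     = jacobi_cert (Suc N) n - jacobi_cert (Suc N) (Suc n)"
proof -
  let ?X = "fps_X :: 'a fps"
  define p where "p = ?X ^ 4"
  define s where "s = (theta_coeff n :: 'a fps)"
  define w where "w = (jacobi_weight (Suc N) n :: 'a fps)"
  define a where "a = ?X ^ (5 * Suc N)"
  define b where "b = ?X ^ (5 * N + 4)"
  define Y where "Y = ?X ^ (2 * n)"
  define z where "z = ?X ^ (5 * n)"
  define d where "d = ?X ^ (5 * (Suc N - n))"
  have pw: "?X ^ (5 * (2 * N + 2)) = a\<^sup>2" "?X ^ (5 * (2 * N + 3)) = a\<^sup>2 * (?X * p)"
    "?X ^ (2 * n + 1) = ?X * Y" "?X ^ (5 * N + 6) = a * ?X"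
    "?X ^ (5 * Suc (Suc N + n)) = a * z * (?X * p)" "?X ^ (2 * Suc n) = Y * ?X\<^sup>2"
    "?X ^ (5 * n + 4) = z * p"
    unfolding a_def z_def Y_def p_def
    by (simp_all flip: power_add power_mult power_Suc power_Suc2)
  have weight: "jacobi_weight N n = w * (1 - d) * (1 - a * z * (?X * p))"
    unfolding jacobi_weight_Suc[OF assms] pw w_def[symmetric] d_def[symmetric] ..
  have "qpoch 5 (Suc N + n + 1) = qpoch 5 (Suc N + n) * (1 - a * z * (?X * p))"
    by (simp only: pw[symmetric] qpoch_Suc Suc_eq_plus1[symmetric])
  then have "fps_recip (qpoch 5 (Suc N - n) * qpoch 5 (Suc N + n)) = w * (1 - a * z * (?X * p))"
    using fps_recip_cancel_left[of "1 - a * z * (?X * p)"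
        "qpoch 5 (Suc N - n) * qpoch 5 (Suc N + n)"] assms
    by (simp add: w_def jacobi_weight_def mult_ac a_def del: qpoch_Suc)
  then have cert: "jacobi_cert (Suc N) n = s * (w * (1 - a * z * (?X * p)))
      * ((?X - a) * (a - d * Y) + (1 - a * ?X) * (d - a * Y))"
    using assms by (simp only: jacobi_cert_def if_True s_def a_def d_def Y_def)
  show ?thesis
  proof (cases "n = Suc N")
    \<comment> \<open>At the top index the next certificate is 0 by definition, and
      \<open>d = 1\<close> removes the weight for \<open>N\<close>.\<close>
    case True
    then have "d = 1" "a = z" and "jacobi_cert (Suc N) (Suc n) = (0 :: 'a fps)"
      by (simp_all add: d_def a_def z_def jacobi_cert_def)
    then show ?thesis
      unfolding weight cert pw s_def[symmetric] w_def[symmetric]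
      by (simp add: algebra_simps power2_eq_square)
  next
    case False
    then have n: "n \<le> N" using assms by simp
    define e where "e = ?X ^ (5 * (N - n))"
    have eqs: "d = e * (?X * p)" "a = e * (?X * p) * z" "b = e * p * z"
      unfolding d_def e_def a_def b_def z_def p_def using n
      by (simp_all add: Suc_diff_le flip: power_add power_mult power_Suc)
    have "qpoch 5 (Suc N - n) = qpoch 5 (N - n) * (1 - d)"
      using n by (simp add: Suc_diff_le d_def)
    then have "fps_recip (qpoch 5 (Suc N - Suc n) * qpoch 5 (Suc N + Suc n)) = w * (1 - d)"
      using fps_recip_cancel_left[of "1 - d" "qpoch 5 (N - n) * qpoch 5 (Suc N + Suc n)"] n
      by (simp add: w_def jacobi_weight_def mult_ac d_def del: qpoch_Suc)
    then have cert': "jacobi_cert (Suc N) (Suc n) = - s * (z * p) * (w * (1 - d))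
      * ((?X - a) * (a - e * (Y * ?X\<^sup>2)) + (1 - a * ?X) * (e - a * (Y * ?X\<^sup>2)))"
      using n by (simp only: jacobi_cert_def if_True pw s_def a_def e_def theta_coeff_Suc
          Suc_le_mono diff_Suc_Suc)
    show ?thesis
      unfolding weight cert cert' pw s_def[symmetric] w_def[symmetric] b_def[symmetric]
      by (rule jacobi_telescope_identity[OF eqs])
  qed
qed

lemma jacobi_sum_Suc:
  "(1 - fps_X ^ (5 * (2 * N + 2))) * (1 - fps_X ^ (5 * (2 * N + 3))) * jacobi_sum (Suc N)
     = (1 - fps_X ^ (5 * N + 6)) * (1 - fps_X ^ (5 * N + 4)) * jacobi_sum N"
proof -
  have extend: "jacobi_sum N = (\<Sum>n\<le>Suc N. theta_coeff n * (1 - fps_X ^ (2 * n + 1)) * jacobi_weight N n :: 'a fps)"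
    by (simp add: jacobi_sum_def jacobi_weight_def)
  have "(1 - fps_X ^ (5 * (2 * N + 2))) * (1 - fps_X ^ (5 * (2 * N + 3))) * jacobi_sum (Suc N)
      - (1 - fps_X ^ (5 * N + 6)) * (1 - fps_X ^ (5 * N + 4)) * jacobi_sum N
      = (\<Sum>n\<le>Suc N. jacobi_cert (Suc N) n - jacobi_cert (Suc N) (Suc n) :: 'a fps)"
    unfolding extend jacobi_sum_def[of "Suc N"] sum_distrib_left sum_subtractf[symmetric]
    by (intro sum.cong refl jacobi_telescope) simp
  \<comment> \<open>The certificate vanishes at 0, where its two brackets cancel, and at
    \<open>N + 2\<close>, beyond its support.\<close>
  also have "\<dots> = 0"
    unfolding sum_telescope by (simp add: jacobi_cert_def)
  finally show ?thesis
    by simp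
qed

text \<open>Residue 1 gets one factor more than residue 4, because the q-binomial theorem behind the
  finite identity has odd order \<open>2 * N + 1\<close>.\<close>

definition jacobi_prod :: "nat \<Rightarrow> 'a::comm_ring_1 fps" where
  "jacobi_prod N = (\<Prod>k\<le>N. 1 - fps_X ^ (5 * k + 1)) * (\<Prod>k<N. 1 - fps_X ^ (5 * k + 4))"

lemma finite_jacobi_triple_product: "qpoch 5 (2 * N + 1) * jacobi_sum N = jacobi_prod N"
proof (induction N)
  case 0
  have "(1 - fps_X ^ 5) * fps_recip (1 - fps_X ^ 5) = (1 :: 'a fps)"
    by (rule fps_recip_right) simp
  then have "(1 - fps_X ^ 5) * ((1 - fps_X) * fps_recip (1 - fps_X ^ 5)) = (1 - fps_X :: 'a fps)"
    by (metis mult.left_commute mult.right_neutral)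
  then show ?case
    by (simp add: jacobi_sum_def jacobi_prod_def jacobi_weight_def)
next
  case (Suc N)
  have "qpoch 5 (2 * Suc N + 1) * jacobi_sum (Suc N) = qpoch 5 (2 * N + 1)
      * ((1 - fps_X ^ (5 * (2 * N + 2))) * (1 - fps_X ^ (5 * (2 * N + 3))) * jacobi_sum (Suc N) :: 'a fps)"
    by (simp add: eval_nat_numeral mult_ac)
  also have "\<dots> = (1 - fps_X ^ (5 * N + 6)) * (1 - fps_X ^ (5 * N + 4)) * jacobi_prod N"
    unfolding jacobi_sum_Suc Suc.IH[symmetric] by (simp only: mult_ac)
  also have "\<dots> = jacobi_prod (Suc N)"
  proof -
    have "5 * Suc N + 1 = 5 * N + 6" by simp
    then show ?thesis
      by (simp only: jacobi_prod_def prod.lessThan_Suc prod.atMost_Suc mult_ac)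
  qed
  finally show ?case .
qed

lemma fps_cong_jacobi_prod: "fps_cong N (qpoch 5 N * jacobi_prod N) (theta_sum (Suc N) 0)"
proof -
  have "qpoch 5 N * jacobi_prod N = (\<Sum>n<Suc N. theta_coeff n * (1 - fps_X ^ (2 * n + 1))
      * (qpoch 5 N * qpoch 5 (2 * N + 1) * jacobi_weight N n) :: 'a fps)"
    unfolding finite_jacobi_triple_product[symmetric] jacobi_sum_def sum_distrib_left
      lessThan_Suc_atMost by (simp only: mult_ac)
  also have "fps_cong N \<dots> (\<Sum>n<Suc N. theta_coeff n * (1 - fps_X ^ (2 * n + 1)) * 1)"
  proof (rule fps_cong_sum)
    fix n assume "n \<in> {..<Suc N}"
    then have n: "n \<le> N" by simp
    let ?u = "qpoch 5 (N - n) * qpoch 5 (N + n + 1) :: 'a fps"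
    have "fps_cong (5 * Suc (N - n)) (qpoch 5 N * qpoch 5 (2 * N + 1)) ?u"
      using n by (intro fps_cong_mult fps_cong_qpoch fps_cong_mono[OF fps_cong_qpoch]) simp_all
    from fps_cong_mult_right[OF this, of "fps_recip ?u"]
    have "fps_cong (5 * Suc (N - n)) (qpoch 5 N * qpoch 5 (2 * N + 1) * jacobi_weight N n) (1 :: 'a fps)"
      using fps_recip_right[of ?u] n by (simp add: jacobi_weight_def del: qpoch_Suc)
    \<comment> \<open>The weight is 1 only up to order \<open>5 * (N - n + 1)\<close>, which is weak
      for large \<open>n\<close>; the factor \<open>q^(4n)\<close> of \<open>theta_coeff n\<close>
      makes up for it.\<close>
    from fps_cong_X_power_mult[OF this, of "4 * n"]
    have "fps_cong N (fps_X ^ (4 * n) * (qpoch 5 N * qpoch 5 (2 * N + 1) * jacobi_weight N n))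
        (fps_X ^ (4 * n) * 1 :: 'a fps)"
      by (rule fps_cong_mono) (use n in simp)
    from fps_cong_mult_left[OF this, of "(-1) ^ n * fps_X ^ (5 * (n choose 2)) * (1 - fps_X ^ (2 * n + 1))"]
    show "fps_cong N (theta_coeff n * (1 - fps_X ^ (2 * n + 1))
        * (qpoch 5 N * qpoch 5 (2 * N + 1) * jacobi_weight N n))
        (theta_coeff n * (1 - fps_X ^ (2 * n + 1)) * 1 :: 'a fps)"
      by (simp only: theta_coeff_def power_add mult_ac)
  qed
  also have "(\<Sum>n<Suc N. theta_coeff n * (1 - fps_X ^ (2 * n + 1)) * 1) = (theta_sum (Suc N) 0 :: 'a fps)"
    by (simp only: theta_sum_def theta_term_def shifted_qpoch_def) simp
  finally show ?thesis .
qed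

section \<open>The second Rogers--Ramanujan identity\<close>

definition rr_denom :: "nat \<Rightarrow> 'a::comm_ring_1 fps" where
  "rr_denom k = (1 - fps_X ^ (5 * k + 2)) * (1 - fps_X ^ (5 * k + 3))"

lemma rr_denom_nth_0 [simp]: "rr_denom k $ 0 = 1"
  by (simp add: rr_denom_def)

text \<open>The exponents up to \<open>5 * N + 1\<close> are sorted by residue modulo 5: 0 goes to
  \<open>qpoch 5 N\<close>, 1 and 4 to \<open>jacobi_prod N\<close>, 2 and 3 to
  \<open>rr_denom\<close>.\<close>

lemma qpoch_5_factorization:
  "qpoch 1 (5 * N + 1) = qpoch 5 N * jacobi_prod N * (\<Prod>k<N. rr_denom k)"
proof (induction N)
  case (Suc N)
  have *: "5 * Suc N + 1 = Suc (Suc (Suc (Suc (Suc (5 * N + 1)))))" by simp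
  have e: "5 * Suc N + 1 = 5 * N + 6" "5 * Suc N = 5 * N + 5" "5 * N + 5 + 1 = 5 * N + 6" by simp_all
  have "qpoch 1 (5 * Suc N + 1) = qpoch 1 (5 * N + 1) * (1 - fps_X ^ (5 * N + 2))
      * (1 - fps_X ^ (5 * N + 3)) * (1 - fps_X ^ (5 * N + 4)) * (1 - fps_X ^ (5 * N + 5))
      * (1 - fps_X ^ (5 * N + 6) :: 'a fps)"
    unfolding * qpoch_Suc by (simp add: numeral_eq_Suc)
  also have "\<dots> = qpoch 5 (Suc N) * jacobi_prod (Suc N) * (\<Prod>k<Suc N. rr_denom k)"
    unfolding Suc.IH
    by (simp only: jacobi_prod_def rr_denom_def[of N] qpoch_Suc prod.lessThan_Suc prod.atMost_Suc e)
      (simp only: mult_ac)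
  finally show ?case .
qed (simp add: jacobi_prod_def)

text \<open>After multiplication by the unit \<open>(q)_(5N+1)\<close> both sides are congruent to
  the theta series for \<open>r = 0\<close>.\<close>

lemma fps_cong_rogers_ramanujan:
  "fps_cong N (rogers_sum (Suc N) 1) (\<Prod>k<N. fps_recip (rr_denom k))"
proof (rule fps_cong_unit_cancel)
  let ?Q = "qpoch 1 (5 * N + 1) :: 'a fps"
  show "?Q $ 0 = 1" by (simp del: qpoch_Suc)
  have "(\<Prod>k<N. rr_denom k) * (\<Prod>k<N. fps_recip (rr_denom k)) = (1 :: 'a fps)"
    unfolding prod.distrib[symmetric] by (simp add: fps_recip_right)
  then have eq: "?Q * (\<Prod>k<N. fps_recip (rr_denom k)) = qpoch 5 N * jacobi_prod N"
    unfolding qpoch_5_factorization by (simp add: mult.assoc)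
  have "fps_cong N (?Q * rogers_sum (Suc N) 1) (theta_sum (Suc N) 0)"
    using fps_cong_rogers_sum_theta_sum[of N "5 * N + 1" 0] by simp
  also have "fps_cong N \<dots> (qpoch 5 N * jacobi_prod N)"
    by (rule fps_cong_sym[OF fps_cong_jacobi_prod])
  finally show "fps_cong N (?Q * rogers_sum (Suc N) 1) (?Q * (\<Prod>k<N. fps_recip (rr_denom k)))"
    unfolding eq .
qed

lemma rogers_ramanujan:
  obtains L :: "'a::idom fps" where
    "(\<lambda>k. fps_recip (rr_denom k)) has_prod L" "\<And>K. fps_cong K (rogers_sum K 1) L"
proof -
  obtain L :: "'a fps" where L: "\<And>K. fps_cong K (rogers_sum K 1) L"
    using fps_cong_limit[of "\<lambda>K. rogers_sum K 1"] fps_cong_rogers_sum_Suc by blast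
  have prod: "fps_cong N (\<Prod>k<N. fps_recip (rr_denom k)) L" for N
    by (rule fps_cong_trans[OF fps_cong_sym[OF fps_cong_rogers_ramanujan] fps_cong_mono[OF L]]) simp
  have "(\<lambda>N. \<Prod>k\<le>N. fps_recip (rr_denom k)) \<longlonglongrightarrow> L"
    by (rule fps_cong_tendsto, rule fps_cong_mono[OF prod[of "Suc _", unfolded lessThan_Suc_atMost]])
       simp
  \<comment> \<open>\<open>has_prod\<close> demands a nonzero limit.\<close>
  moreover have "L $ 0 = 1"
    using prod[of 1] by (simp add: fps_cong_iff_nth)
  then have "L \<noteq> 0" by auto
  ultimately have "(\<lambda>k. fps_recip (rr_denom k)) has_prod L"
    by (simp add: has_prod_def raw_has_prod_def)
  with L that show thesis by blast
qed

section \<open>Clearing the common factor\<close>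

theorem theorem1:
  fixes M :: nat
  assumes "M > 0" and "(M + 1) mod 5 = 2 \<or> (M + 1) mod 5 = 3"
  shows "summable (\<lambda>k. qX ^ ((k + (M + 1)) * (k + (M + 1) + 1))
             \<oslash> ((1 - tX * qX ^ (M + 1)) * (\<Prod>i\<in>{1..k + (M + 1)} - {M + 1}. 1 - qX ^ i)))
     \<and> convergent_prod (\<lambda>k. 1 \<oslash> ((1 - qX ^ (5 * k + 2)) * (1 - qX ^ (5 * k + 3))))
     \<and> 1 + qX ^ 2 * (((\<Sum>i<M - 1. qX ^ i) + tX * qX ^ (M - 1) + qX ^ M) \<oslash> (1 - tX * qX ^ (M + 1)))
         + (\<Sum>k = 2..M. (qX ^ (k * (k + 1)) \<oslash> (\<Prod>i = 2..k. 1 - qX ^ i))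
                         * (q_int (M + 1) \<oslash> (1 - tX * qX ^ (M + 1))))
         + (\<Sum>k. qX ^ ((k + (M + 1)) * (k + (M + 1) + 1))
             \<oslash> ((1 - tX * qX ^ (M + 1)) * (\<Prod>i\<in>{1..k + (M + 1)} - {M + 1}. 1 - qX ^ i)))
       = ((1 - qX ^ (M + 1)) \<oslash> (1 - tX * qX ^ (M + 1)))
         * (\<Prod>k. 1 \<oslash> ((1 - qX ^ (5 * k + 2)) * (1 - qX ^ (5 * k + 3))))"
proof -
  define v where "v = 1 - tX * qX ^ (M + 1)"
  define p where "p = 1 - qX ^ (M + 1)"
  define rr where "rr k = qX ^ (k * k + 1 * k) * fps_recip (qpoch 1 k)" for k
  have v0: "v $ 0 = 1" and p0: "p $ 0 = 1"
    by (simp_all add: v_def p_def)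
  obtain L :: "int poly fps" where prodL: "(\<lambda>k. fps_recip (rr_denom k)) has_prod L"
    and L: "\<And>K. fps_cong K (rogers_sum K 1) L"
    using rogers_ramanujan[where 'a = "int poly"] by blast
  have denom: "1 \<oslash> ((1 - qX ^ (5 * k + 2)) * (1 - qX ^ (5 * k + 3))) = fps_recip (rr_denom k)" for k
    by (simp add: fps_quot_def rr_denom_def)
  have prod: "convergent_prod (\<lambda>k. 1 \<oslash> ((1 - qX ^ (5 * k + 2)) * (1 - qX ^ (5 * k + 3))))"
    "(\<Prod>k. 1 \<oslash> ((1 - qX ^ (5 * k + 2)) * (1 - qX ^ (5 * k + 3)))) = L"
    unfolding denom using prodL has_prod_unique[OF prodL]
    by (auto simp: convergent_prod_def has_prod_def)
  have tail_term: "qX ^ ((k + (M + 1)) * (k + (M + 1) + 1))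
      \<oslash> (v * (\<Prod>i\<in>{1..k + (M + 1)} - {M + 1}. 1 - qX ^ i)) = (p \<oslash> v) * rr (k + (M + 1))" for k
  proof -
    let ?n = "k + (M + 1)"
    let ?P = "\<Prod>i\<in>{1..?n} - {M + 1}. 1 - qX ^ i"
    \<comment> \<open>The factor absent from the denominator is exactly \<open>p\<close>.\<close>
    have "qpoch 1 ?n = p * ?P"
      unfolding qpoch_def p_def by (subst prod.remove[of _ "M + 1"]) auto
    moreover have "?P $ 0 = 1"
      by (auto simp: fps_prod_nth_0' intro!: prod.neutral)
    ultimately have "fps_recip (qpoch 1 ?n) * p = fps_recip ?P"
      and "fps_recip (v * ?P) = fps_recip v * fps_recip ?P"
      using fps_recip_cancel_left[OF p0, of ?P] fps_recip_mult[OF v0, of ?P]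
      by simp_all
    then show ?thesis
      by (simp add: fps_quot_def rr_def algebra_simps)
  qed
  let ?tail = "\<lambda>k. (p \<oslash> v) * rr (k + (M + 1))"
  have "?tail sums ((p \<oslash> v) * (L - (\<Sum>k\<le>M. rr k)))"
    unfolding sums_def
  proof (rule fps_cong_tendsto)
    fix K
    have "(\<Sum>k<K. ?tail k) = (p \<oslash> v) * (\<Sum>k=M+1..<K+(M+1). rr k)"
      unfolding sum_distrib_left
      using sum.shift_bounds_nat_ivl[of "\<lambda>k. (p \<oslash> v) * rr k" 0 "M + 1" K]
      by (simp add: atLeast0LessThan)
    also have "(\<Sum>k=M+1..<K+(M+1). rr k) = rogers_sum (K + (M + 1)) 1 - (\<Sum>k\<le>M. rr k)"
      using sum.atLeastLessThan_concat[of 0 "M + 1" "K + (M + 1)" rr]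
      unfolding rogers_sum_def rr_def[symmetric]
      by (simp add: atLeast0LessThan lessThan_Suc_atMost algebra_simps)
    finally have "(\<Sum>k<K. ?tail k) = (p \<oslash> v) * (rogers_sum (K + (M + 1)) 1 - (\<Sum>k\<le>M. rr k))" .
    moreover have "fps_cong K (rogers_sum (K + (M + 1)) 1 - (\<Sum>k\<le>M. rr k)) (L - (\<Sum>k\<le>M. rr k))"
      using fps_cong_mono[OF L[of "K + (M + 1)"], of K] by (simp add: fps_cong_def)
    ultimately show "fps_cong K (\<Sum>k<K. ?tail k) ((p \<oslash> v) * (L - (\<Sum>k\<le>M. rr k)))"
      by (simp only: fps_cong_mult_left)
  qed
  then have tail: "summable ?tail" "(\<Sum>k. ?tail k) = (p \<oslash> v) * (L - (\<Sum>k\<le>M. rr k))"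
    by (auto simp: sums_iff)
  \<comment> \<open>For \<open>k \<ge> 2\<close> this accounts for the denominators without the
    factor \<open>1 - q\<close>: \<open>1 - q\<close> is taken out of \<open>p\<close>, leaving
    \<open>[M+1]_q\<close>.\<close>
  have q_int: "p = (1 - qX) * q_int (M + 1)"
    unfolding p_def q_int_def by (rule one_diff_power_eq)
  have rr1: "p * rr 1 = qX\<^sup>2 * q_int (M + 1)"
  proof -
    have "p * rr 1 = ((1 - qX) * fps_recip (1 - qX)) * (qX\<^sup>2 * q_int (M + 1))"
      by (simp add: q_int rr_def mult_ac power2_eq_square)
    also have "(1 - qX) * fps_recip (1 - qX) = 1"
      by (rule fps_recip_right) simp
    finally show ?thesis
      by simp
  qed
  have mid: "(qX ^ (k * (k + 1)) \<oslash> (\<Prod>i = 2..k. 1 - qX ^ i)) * (q_int (M + 1) \<oslash> v)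
      = (p \<oslash> v) * rr k" if "k \<in> {2..M}" for k
  proof -
    let ?P = "\<Prod>i=2..k. 1 - qX ^ i"
    have "qpoch 1 k = (1 - qX) * ?P"
      unfolding qpoch_def using that
      by (subst prod.atLeast_Suc_atMost) (auto simp: numeral_2_eq_2)
    moreover have "?P $ 0 = 1"
      by (auto simp: fps_prod_nth_0' intro!: prod.neutral)
    ultimately have recip: "fps_recip (qpoch 1 k) * (1 - qX) = fps_recip ?P"
      using fps_recip_cancel_left[of "1 - qX" ?P] by simp
    have "(p \<oslash> v) * rr k
        = qX ^ (k * (k + 1)) * (fps_recip (qpoch 1 k) * (1 - qX)) * (q_int (M + 1) * fps_recip v)"
      by (simp add: q_int fps_quot_def rr_def algebra_simps)
    then show ?thesis
      by (simp only: recip fps_quot_def)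
  qed
  have head: "1 + qX ^ 2 * (((\<Sum>i<M - 1. qX ^ i) + tX * qX ^ (M - 1) + qX ^ M) \<oslash> v)
      = (p \<oslash> v) * (rr 0 + rr 1)"
  proof -
    obtain m where m: "M = Suc m"
      using assms(1) gr0_conv_Suc by blast
    have rr0: "rr 0 = 1"
      using fps_recip_unique[of "1 :: int poly fps" 1] by (simp add: rr_def)
    \<comment> \<open>The \<open>t\<close>-term of the numerator cancels that of \<open>v\<close>,
      and \<open>-q^(M+1)\<close> from \<open>p\<close> cancels the power \<open>q^(M-1)\<close> of
      \<open>[M+1]_q\<close> multiplied by \<open>q^2\<close>.\<close>
    have clear: "v + qX\<^sup>2 * ((\<Sum>i<M - 1. qX ^ i) + tX * qX ^ (M - 1) + qX ^ M) = p * (rr 0 + rr 1)"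
      unfolding distrib_left rr1 rr0 by (simp add: m v_def p_def q_int_def algebra_simps power2_eq_square)
    have common: "1 + qX\<^sup>2 * (f \<oslash> v) = (v + qX\<^sup>2 * f) \<oslash> v" for f
      by (simp only: fps_quot_def distrib_right fps_recip_right[OF v0] mult.assoc)
    show ?thesis
      unfolding common clear by (simp only: fps_quot_def mult_ac)
  qed
  have "(\<Sum>k\<le>M. rr k) = rr 0 + rr 1 + (\<Sum>k=2..M. rr k)"
    using assms(1) by (simp add: atMost_atLeast0 sum.atLeast_Suc_atMost numeral_2_eq_2 add.assoc)
  then have "(p \<oslash> v) * (rr 0 + rr 1) + (\<Sum>k=2..M. (p \<oslash> v) * rr k)
      + (p \<oslash> v) * (L - (\<Sum>k\<le>M. rr k)) = (p \<oslash> v) * L"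
    unfolding sum_distrib_left[symmetric] by (simp only: distrib_left[symmetric]) simp
  moreover have "(\<Sum>k = 2..M. (qX ^ (k * (k + 1)) \<oslash> (\<Prod>i = 2..k. 1 - qX ^ i)) * (q_int (M + 1) \<oslash> v))
      = (\<Sum>k=2..M. (p \<oslash> v) * rr k)"
    by (intro sum.cong refl mid)
  ultimately show ?thesis
    using tail(1) prod(1)
    unfolding v_def[symmetric] p_def[symmetric] tail_term tail(2) prod(2) head by simp
qed

end
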